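(* Let $R$ be a subset of $\mathbb{K}[[X]]$. Then $R$ is a standard basis of the ideal of $\mathbb{K}[[X]]$ it generates if and only if the rewriting relation $\to_{F(R)}$ is $\delta$-confluent.
   Context: Let $\mathbb{K}$ be a commutative field (with the discrete topology), $X=\{x_1,\dots,x_n\}$ a finite set of indeterminates, $\mathbb{K}[X]$ the commutative polynomial algebra and $\mathbb{K}[[X]]$ the algebra of commutative formal power series. Let $G$ be the set of commutative monomials over $X$. The support $\mathrm{supp}(f)$ of a series $f=\sum \alpha_m m$ is the set of monomials $m$ with $\alpha_m\neq 0$. Order and metric. Let $<$ be a monomial order (a well-order on $G$ compatible with multiplication) which is compatible with degrees: $\deg(m)<\deg(m')$ implies $m<m'$. Let $<_{\mathrm{red}}$ be the opposite order of $<$ ($m<_{\mathrm{red}}m'$ iff $m'<m$). Let $d(m)=1/2^{\deg(m)}$ and let $\delta$ be the metric $\delta(f,g)=\max\{d(m)\mid m\in\mathrm{supp}(f-g)\}$ (with $\delta(f,f)=0$), i.e. $\delta(f,g)=1/2^k$ with $k$ the smallest degree of a monomial occurring in $f-g$. $\mathbb{K}[[X]]$ is the completion of $\mathbb{K}[X]$ for $\delta$. For nonzero $f\in\mathbb{K}[[X]]$, $\mathrm{lm}(f)$ is the greatest element of $\mathrm{supp}(f)$ for $<_{\mathrm{red}}$, i.e. the smallest for $<$. For a subset $E$, $\mathrm{lm}(E)$ is the set of leading monomials of nonzero elements of $E$. Standard basis. A standard basis of an ideal $I$ of $\mathbb{K}[[X]]$ is a generating set $R$ of $I$ such that $\mathrm{lm}(R)$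 generates the monomial ideal $\mathrm{lm}(I)$, i.e. every element of $\mathrm{lm}(I)$ is divisible by an element of $\mathrm{lm}(R)$. Reduction operators. A reduction operator is a continuous linear projector $T$ of $\mathbb{K}[[X]]$ such that for every monomial $m$, $T(m)\neq m$ implies $m'<_{\mathrm{red}}m$ for every $m'\in\mathrm{supp}(T(m))$. The map $T\mapsto\ker(T)$ is a bijection between reduction operators and closed subspaces of $\mathbb{K}[[X]]$. For $f\in\mathbb{K}[[X]]$, $T(f)$ denotes the reduction operator whose kernel is the closure of the ideal generated by $f$, and $F(R)=\{T(f)\mid f\in R\}$. Rewriting. For a set $F$ of reduction operators, $\to_F$ is the binary relation on $\mathbb{K}[[X]]$ given by $v\to_F T(v)$ for all $v\in\mathbb{K}[[X]]$ and $T\in F$. Say that $v$ rewrites into $v'$ if $(v,v')$ is in the reflexive transitive closure of $\to_F$. Write $v\Rightarrow_F w$ if every neighbourhood (for $\delta$) of $w$ contains some $w'$ such that $v$ rewrites into $w'$. The relation $\to_F$ is $\delta$-confluent if whenever $a$ rewrites into $b$ and into $c$, there exists $e$ with $b\Rightarrow_F e$ and $c\Rightarrow_F e$. *)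

theory Defs
  imports "HOL-Analysis.Analysis" "HOL-Library.Multiset"
begin

section \<open>Commutative formal power series\<close>

text \<open>
  Commutative monomials over the indeterminates \<open>'x\<close> are multisets over \<open>'x\<close>: the product of
  monomials is \<open>+\<close>, the unit is \<open>{#}\<close>, the degree is \<^const>\<open>size\<close> and divisibility is \<open>\<subseteq>#\<close>.
\<close>

typedef ('x, 'k) mps = "UNIV :: ('x multiset \<Rightarrow> 'k) set"
  morphisms coeff Abs_mps ..

setup_lifting type_definition_mps

lemma mps_eqI: "(\<And>m. coeff f m = coeff g m) \<Longrightarrow> f = g"
  by transfer auto

lemma coeff_Abs_mps [simp]: "coeff (Abs_mps h) m = h m"
  by (simp add: Abs_mps_inverse)

instantiation mps :: (type, zero) zero
begin
lift_definition zero_mps :: "('a, 'b) mps" is "\<lambda>_. 0" .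
instance ..
end

instantiation mps :: (type, ab_group_add) ab_group_add
begin
lift_definition plus_mps :: "('a, 'b) mps \<Rightarrow> ('a, 'b) mps \<Rightarrow> ('a, 'b) mps"
  is "\<lambda>f g m. f m + g m" .
lift_definition minus_mps :: "('a, 'b) mps \<Rightarrow> ('a, 'b) mps \<Rightarrow> ('a, 'b) mps"
  is "\<lambda>f g m. f m - g m" .
lift_definition uminus_mps :: "('a, 'b) mps \<Rightarrow> ('a, 'b) mps"
  is "\<lambda>f m. - f m" .
instance
  by (standard; transfer; simp add: fun_eq_iff)
end

lemma coeff_zero [simp]: "coeff 0 m = 0"
  and coeff_plus [simp]: "coeff (f + g) m = coeff f m + coeff g m"
  and coeff_minus [simp]: "coeff (f - g) m = coeff f m - coeff g m"
  and coeff_uminus [simp]: "coeff (- f) m = - coeff f m"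
  by (transfer; simp)+

definition splits :: "'x multiset \<Rightarrow> ('x multiset \<times> 'x multiset) set" where
  "splits m = {(a, b). a + b = m}"

lemma finite_splits [simp]: "finite (splits m)"
proof (induction m)
  case empty
  then show ?case by (simp add: splits_def)
next
  case (add x m)
  let ?S = "(\<lambda>(a, b). (add_mset x a, b)) ` splits m \<union> (\<lambda>(a, b). (a, add_mset x b)) ` splits m"
  have "(a, b) \<in> ?S" if "a + b = add_mset x m" for a b
  proof -
    from that have "x \<in># a \<or> x \<in># b"
      by (metis union_iff union_single_eq_member)
    then show ?thesis
    proof
      assume "x \<in># a"
      then obtain a' where a': "a = add_mset x a'" by (meson multi_member_split)
      with that have "(a', b) \<in> splits m" by (simp add: splits_def)
      with a' show ?thesis by force
    next
      assume "x \<in># b"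
      then obtain b' where b': "b = add_mset x b'" by (meson multi_member_split)
      with that have "(a, b') \<in> splits m" by (simp add: splits_def)
      with b' show ?thesis by force
    qed
  qed
  then have "splits (add_mset x m) \<subseteq> ?S"
    by (auto simp only: splits_def)
  moreover have "finite ?S" using add by blast
  ultimately show ?case by (rule finite_subset)
qed

definition mps_monom :: "'x multiset \<Rightarrow> ('x, 'k::comm_ring_1) mps" where
  "mps_monom m = Abs_mps (\<lambda>m'. if m' = m then 1 else 0)"

instantiation mps :: (type, comm_ring_1) comm_ring_1
begin

definition one_mps :: "('a, 'b) mps" where
  "one_mps = mps_monom {#}"

definition times_mps :: "('a, 'b) mps \<Rightarrow> ('a, 'b) mps \<Rightarrow> ('a, 'b) mps" where
  "f * g = Abs_mps (\<lambda>m. \<Sum>(a, b)\<in>splits m. coeff f a * coeff g b)"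

lemma coeff_times:
  "coeff (f * g :: ('a, 'b) mps) m = (\<Sum>(a, b)\<in>splits m. coeff f a * coeff g b)"
  by (simp add: times_mps_def)

instance
proof
  fix f g h :: "('a, 'b) mps"
  show "f * g * h = f * (g * h)"
  proof (rule mps_eqI)
    fix m
    let ?t = "\<lambda>a b c. coeff f a * coeff g b * coeff h c"
    have "coeff (f * g * h) m =
        (\<Sum>p\<in>splits m. \<Sum>q\<in>splits (fst p). ?t (fst q) (snd q) (snd p))"
      by (simp add: coeff_times sum_distrib_right case_prod_beta)
    also have "\<dots> = (\<Sum>(p, q)\<in>(SIGMA p:splits m. splits (fst p)). ?t (fst q) (snd q) (snd p))"
      by (rule sum.Sigma) auto
    also have "\<dots> = (\<Sum>(p, q)\<in>(SIGMA p:splits m. splits (snd p)). ?t (fst p) (fst q) (snd q))"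
      by (rule sum.reindex_bij_witness[of _
            "\<lambda>((a, _), (b, c)). ((a + b, c), (a, b))" "\<lambda>((_, c), (a, b)). ((a, b + c), (b, c))"])
        (auto simp: splits_def add.assoc)
    also have "\<dots> = (\<Sum>p\<in>splits m. \<Sum>q\<in>splits (snd p). ?t (fst p) (fst q) (snd q))"
      by (rule sum.Sigma[symmetric]) auto
    also have "\<dots> = coeff (f * (g * h)) m"
      by (simp add: coeff_times sum_distrib_left case_prod_beta mult.assoc)
    finally show "coeff (f * g * h) m = coeff (f * (g * h)) m" .
  qed
  show "f * g = g * f"
  proof (rule mps_eqI)
    fix m
    show "coeff (f * g) m = coeff (g * f) m"
      unfolding coeff_times
      by (rule sum.reindex_bij_witness[of _ prod.swap prod.swap])
        (auto simp: splits_def add.commute mult.commute)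
  qed
  show "1 * f = f"
  proof (rule mps_eqI)
    fix m
    have "coeff (1 * f) m = (\<Sum>p\<in>splits m. if p = ({#}, m) then coeff f m else 0)"
      unfolding coeff_times
      by (rule sum.cong) (auto simp: splits_def one_mps_def mps_monom_def split: if_splits)
    also have "\<dots> = coeff f m"
      by (subst sum.delta[OF finite_splits]) (simp add: splits_def)
    finally show "coeff (1 * f) m = coeff f m" .
  qed
  show "(f + g) * h = f * h + g * h"
    by (rule mps_eqI) (simp add: coeff_times case_prod_beta distrib_right sum.distrib)
  show "(0 :: ('a, 'b) mps) \<noteq> 1"
  proof
    assume "(0 :: ('a, 'b) mps) = 1"
    then have "coeff (0 :: ('a, 'b) mps) {#} = coeff 1 {#}" by simp
    then show False by (simp add: one_mps_def mps_monom_def)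
  qed
qed

end

definition scale :: "'k \<Rightarrow> ('x, 'k::field) mps \<Rightarrow> ('x, 'k) mps" where
  "scale c f = Abs_mps (\<lambda>m. c * coeff f m)"

lemma vector_space_scale: "vector_space (scale :: 'k::field \<Rightarrow> ('x, 'k) mps \<Rightarrow> _)"
  by standard (auto intro!: mps_eqI simp: scale_def algebra_simps)

definition supp :: "('x, 'k::zero) mps \<Rightarrow> 'x multiset set" where
  "supp f = {m. coeff f m \<noteq> 0}"

lemma module_mps: "module ((*) :: ('x, 'k::comm_ring_1) mps \<Rightarrow> _)"
  by standard (simp_all add: algebra_simps)

definition ideal_gen :: "('x, 'k::comm_ring_1) mps set \<Rightarrow> ('x, 'k) mps set" where
  "ideal_gen R = module.span (*) R"


section \<open>The metric\<close>

instantiation mps :: (type, ab_group_add) metric_space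
begin

definition dist_mps :: "('a, 'b) mps \<Rightarrow> ('a, 'b) mps \<Rightarrow> real" where
  "dist f g = (if f = g then 0 else 1 / 2 ^ (LEAST k. \<exists>m\<in>supp (f - g). size m = k))"

definition uniformity_mps :: "(('a, 'b) mps \<times> ('a, 'b) mps) filter" where
  "uniformity_mps = (INF e\<in>{0 <..}. principal {(x, y). dist x y < e})"

definition open_mps :: "('a, 'b) mps set \<Rightarrow> bool" where
  "open_mps U \<longleftrightarrow> (\<forall>x\<in>U. eventually (\<lambda>(x', y). x' = x \<longrightarrow> y \<in> U) uniformity)"

lemma dist_mps_attained:
  assumes "f \<noteq> (g :: ('a, 'b) mps)"
  shows "\<exists>m\<in>supp (f - g). dist f g = 1 / 2 ^ size m"
proof -
  define n where "n = (LEAST k. \<exists>m\<in>supp (f - g). size m = k)"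
  from assms obtain m where "m \<in> supp (f - g)"
    using mps_eqI[of f g] by (auto simp: supp_def)
  then have "\<exists>k. \<exists>m\<in>supp (f - g). size m = k" by blast
  then have "\<exists>m\<in>supp (f - g). size m = n"
    unfolding n_def by (rule LeastI_ex)
  moreover have "dist f g = 1 / 2 ^ n"
    using assms unfolding dist_mps_def n_def by (simp only: if_False)
  ultimately show ?thesis by blast
qed

lemma dist_mps_upper:
  assumes "m \<in> supp (f - g :: ('a, 'b) mps)"
  shows "1 / 2 ^ size m \<le> dist f g"
proof -
  define n where "n = (LEAST k. \<exists>m\<in>supp (f - g). size m = k)"
  from assms have "f \<noteq> g" by (auto simp: supp_def)
  then have "dist f g = 1 / 2 ^ n"
    unfolding dist_mps_def n_def by (simp only: if_False)
  moreover have "n \<le> size m"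
    unfolding n_def by (rule Least_le) (use assms in blast)
  ultimately show ?thesis by (simp add: frac_le)
qed

instance
proof
  have pos: "0 \<le> dist f g" for f g :: "('a, 'b) mps"
    by (simp add: dist_mps_def)
  show "dist f g = 0 \<longleftrightarrow> f = g" for f g :: "('a, 'b) mps"
    by (simp add: dist_mps_def)
  fix f g h :: "('a, 'b) mps"
  show "dist f g \<le> dist f h + dist g h"
  proof (cases "f = g")
    case True
    then show ?thesis using pos[of f h] pos[of g h] by (simp add: dist_mps_def)
  next
    case False
    from dist_mps_attained[OF False]
    obtain m where m: "m \<in> supp (f - g)" "dist f g = 1 / 2 ^ size m" by blast
    from m(1) have "m \<in> supp (f - h) \<or> m \<in> supp (g - h)"
      by (auto simp: supp_def)
    then have "dist f g \<le> dist f h \<or> dist f g \<le> dist g h"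
      using dist_mps_upper[of m f h] dist_mps_upper[of m g h] m(2) by auto
    then show ?thesis using pos[of f h] pos[of g h] by linarith
  qed
qed (rule uniformity_mps_def open_mps_def)+

end


section \<open>Leading monomials and standard bases\<close>

text \<open>
  A monomial order is represented by its strict part \<open>lt\<close>; the opposite order is \<open>lt\<inverse>\<inverse>\<close>.
\<close>

definition deg_monomial_order :: "('x multiset \<Rightarrow> 'x multiset \<Rightarrow> bool) \<Rightarrow> bool" where
  "deg_monomial_order lt \<longleftrightarrow>
     irreflp lt \<and> transp lt \<and> totalp lt \<and> wfp lt \<and>
     (\<forall>a b c. lt a b \<longrightarrow> lt (a + c) (b + c)) \<and>
     (\<forall>a b. size a < size b \<longrightarrow> lt a b)"

definition lm :: "('x multiset \<Rightarrow> 'x multiset \<Rightarrow> bool) \<Rightarrow> ('x, 'k::zero) mps \<Rightarrow> 'x multiset" where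
  "lm lt f = (THE m. m \<in> supp f \<and> (\<forall>m'\<in>supp f. m' \<noteq> m \<longrightarrow> lt\<inverse>\<inverse> m' m))"

definition lms :: "('x multiset \<Rightarrow> 'x multiset \<Rightarrow> bool) \<Rightarrow> ('x, 'k::zero) mps set \<Rightarrow> 'x multiset set" where
  "lms lt E = lm lt ` (E - {0})"

definition standard_basis ::
  "('x multiset \<Rightarrow> 'x multiset \<Rightarrow> bool) \<Rightarrow> ('x, 'k::field) mps set \<Rightarrow> ('x, 'k) mps set \<Rightarrow> bool" where
  "standard_basis lt R I \<longleftrightarrow>
     ideal_gen R = I \<and> (\<forall>m\<in>lms lt I. \<exists>m'\<in>lms lt R. m' \<subseteq># m)"


section \<open>Reduction operators\<close>

definition reduction_operator ::
  "('x multiset \<Rightarrow> 'x multiset \<Rightarrow> bool) \<Rightarrow> (('x, 'k::field) mps \<Rightarrow> ('x, 'k) mps) \<Rightarrow> bool" where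
  "reduction_operator lt T \<longleftrightarrow>
     Vector_Spaces.linear scale scale T \<and> continuous_on UNIV T \<and> T \<circ> T = T \<and>
     (\<forall>m. T (mps_monom m) \<noteq> mps_monom m \<longrightarrow>
        (\<forall>m'\<in>supp (T (mps_monom m)). lt\<inverse>\<inverse> m' m))"

text \<open>
  The description below is meaningful because \<open>T \<mapsto> ker T\<close> is a bijection between
  reduction operators and closed subspaces (for finitely many indeterminates and \<open>lt\<close>
  a monomial order compatible with degrees).
\<close>

definition red_op ::
  "('x multiset \<Rightarrow> 'x multiset \<Rightarrow> bool) \<Rightarrow> ('x, 'k::field) mps \<Rightarrow> ('x, 'k) mps \<Rightarrow> ('x, 'k) mps" where
  "red_op lt f = (THE T. reduction_operator lt T \<and> {v. T v = 0} = closure (ideal_gen {f}))"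


section \<open>Topological rewriting\<close>

definition rewr :: "('a \<Rightarrow> 'a) set \<Rightarrow> 'a \<Rightarrow> 'a \<Rightarrow> bool" where
  "rewr F v v' \<longleftrightarrow> (\<exists>T\<in>F. v' = T v)"

definition top_rewr :: "('a::topological_space \<Rightarrow> 'a) set \<Rightarrow> 'a \<Rightarrow> 'a \<Rightarrow> bool" where
  "top_rewr F v w \<longleftrightarrow> (\<forall>U. open U \<and> w \<in> U \<longrightarrow> (\<exists>w'\<in>U. (rewr F)\<^sup>*\<^sup>* v w'))"

definition top_confluent :: "('a::topological_space \<Rightarrow> 'a) set \<Rightarrow> bool" where
  "top_confluent F \<longleftrightarrow>
     (\<forall>a b c. (rewr F)\<^sup>*\<^sup>* a b \<and> (rewr F)\<^sup>*\<^sup>* a c \<longrightarrow> (\<exists>e. top_rewr F b e \<and> top_rewr F c e))"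

end

theory Submission
  imports Defs
begin

text \<open>
  A reduction operator \<open>T\<close> with kernel \<open>V\<close> sends a series \<open>v\<close> to its normal form modulo \<open>V\<close>: the
  only element of \<open>v + V\<close> whose support avoids the leading monomials of \<open>V\<close>. If \<open>V\<close> is the closure
  of the ideal of \<open>f \<noteq> 0\<close>, these are the multiples of the leading monomial of \<open>f\<close>. So one rewriting
  step by \<open>f\<close> removes all these multiples from the support, changes nothing below the least one
  that occurs, stays in the same class modulo the closed ideal, and does not expand distances.

  Suppose that \<open>R\<close> is a standard basis of \<open>I\<close>. Rewriting can clear all reducible monomials up to
  any degree, since each step raises the least one and only finitely many have bounded degree.
  Two results of rewriting the same series that are clear up to degree \<open>N\<close> differ by an element
  of the closure of \<open>I\<close>. The leading monomials of \<open>I\<close> are reducible, so a disagreement of the two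
  results up to degree \<open>N\<close> would put a reducible monomial of such a degree in one of the supports. All these
  results therefore glue to one series, to which both sides of a branching converge
  (\<open>confluent_if_standard_basis\<close>).

  Conversely, suppose that rewriting is topologically confluent. Since rewriting does not expand
  distances, it is confluent in the ordinary sense up to any fixed degree, and joinability up to
  that degree is transitive. The reduction operator of \<open>f\<close> takes the same value on \<open>c * f + y\<close>
  and \<open>y\<close>, so every \<open>h\<close> in the ideal is joinable with \<open>0\<close> up to any degree
  (\<open>ideal_joinable_zero\<close>), and \<open>0\<close> rewrites only into itself. But a leading monomial that no
  element of \<open>R\<close> reduces would survive all rewriting (\<open>rewrites_irreducible_lm\<close>), so the leading
  monomial of \<open>h\<close> is reducible.
\<close>


section \<open>The topology through coefficients\<close>

definition agree_upto :: "nat \<Rightarrow> ('x, 'k) mps \<Rightarrow> ('x, 'k) mps \<Rightarrow> bool" where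
  "agree_upto N f g \<longleftrightarrow> (\<forall>m. size m \<le> N \<longrightarrow> coeff f m = coeff g m)"

lemma agree_uptoD: "agree_upto N f g \<Longrightarrow> size m \<le> N \<Longrightarrow> coeff f m = coeff g m"
  by (simp add: agree_upto_def)

lemma agree_upto_refl [simp]: "agree_upto N f f"
  by (simp add: agree_upto_def)

lemma agree_upto_sym: "agree_upto N f g \<Longrightarrow> agree_upto N g f"
  by (simp add: agree_upto_def)

lemma agree_upto_trans [trans]: "agree_upto N f g \<Longrightarrow> agree_upto N g h \<Longrightarrow> agree_upto N f h"
  by (simp add: agree_upto_def)

lemma agree_upto_eqI: "(\<And>N. agree_upto N f g) \<Longrightarrow> f = g"
  by (rule mps_eqI) (auto simp: agree_upto_def)

lemma coeff_scale [simp]: "coeff (scale c f) m = c * coeff f m"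
  by (simp add: scale_def)

lemma coeff_monom: "coeff (mps_monom m) m' = (if m' = m then 1 else 0)"
  by (simp add: mps_monom_def)

lemma supp_iff: "m \<in> supp f \<longleftrightarrow> coeff f m \<noteq> 0"
  by (simp add: supp_def)

lemma supp_nonempty: "f \<noteq> 0 \<Longrightarrow> \<exists>m. m \<in> supp f"
  using mps_eqI[of f 0] by (auto simp: supp_iff)

lemma dist_less_iff_agree_upto:
  "dist f g < 1 / 2 ^ N \<longleftrightarrow> agree_upto N f (g :: ('x, 'k::ab_group_add) mps)"
proof
  assume d: "dist f g < 1 / 2 ^ N"
  show "agree_upto N f g"
    unfolding agree_upto_def
  proof (intro allI impI, rule ccontr)
    fix m :: "'x multiset"
    assume m: "size m \<le> N" "coeff f m \<noteq> coeff g m"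
    then have "m \<in> supp (f - g)" by (simp add: supp_iff)
    from dist_mps_upper[OF this] d have "(1::real) / 2 ^ size m < 1 / 2 ^ N" by linarith
    moreover have "(1::real) / 2 ^ N \<le> 1 / 2 ^ size m"
      using m(1) by (intro divide_left_mono power_increasing) auto
    ultimately show False by linarith
  qed
next
  assume a: "agree_upto N f g"
  show "dist f g < 1 / 2 ^ N"
  proof (cases "f = g")
    case True
    then show ?thesis by simp
  next
    case False
    from dist_mps_attained[OF this] obtain m
      where m: "m \<in> supp (f - g)" "dist f g = 1 / 2 ^ size m" by blast
    then have "N < size m"
      using agree_uptoD[OF a, of m] by (force simp: supp_iff not_le)
    then have "(1::real) / 2 ^ size m < 1 / 2 ^ N"
      by (intro divide_strict_left_mono power_strict_increasing) auto
    then show ?thesis using m(2) by simp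
  qed
qed

lemma half_power_small:
  assumes "0 < (e::real)"
  obtains N :: nat where "1 / 2 ^ N < e"
  using real_arch_pow_inv[OF assms, of "1/2"] by (auto simp: power_one_over)

lemma mem_closure_iff:
  fixes f :: "('x, 'k::ab_group_add) mps"
  shows "f \<in> closure S \<longleftrightarrow> (\<forall>N. \<exists>g\<in>S. agree_upto N g f)"
proof
  assume "f \<in> closure S"
  then show "\<forall>N. \<exists>g\<in>S. agree_upto N g f"
    by (auto simp: closure_approachable simp flip: dist_less_iff_agree_upto)
next
  assume a: "\<forall>N. \<exists>g\<in>S. agree_upto N g f"
  have "\<exists>g\<in>S. dist g f < e" if "0 < e" for e
  proof -
    from that obtain N :: nat where N: "1 / 2 ^ N < e" by (rule half_power_small)
    from a obtain g where "g \<in> S" "agree_upto N g f" by blast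
    then show ?thesis using N by (force simp flip: dist_less_iff_agree_upto)
  qed
  then show "f \<in> closure S" by (simp add: closure_approachable)
qed

lemma top_rewr_iff:
  fixes v w :: "('x, 'k::ab_group_add) mps"
  shows "top_rewr F v w \<longleftrightarrow> (\<forall>N. \<exists>w'. agree_upto N w' w \<and> (rewr F)\<^sup>*\<^sup>* v w')"
proof -
  have "top_rewr F v w \<longleftrightarrow> w \<in> closure {w'. (rewr F)\<^sup>*\<^sup>* v w'}"
    unfolding top_rewr_def closure_iff_nhds_not_empty by blast
  then show ?thesis by (auto simp: mem_closure_iff)
qed

text \<open>Completeness, in the form of glueing coherent truncations.\<close>

lemma agree_upto_limit:
  assumes "\<And>M N. M \<le> N \<Longrightarrow> agree_upto M (w M) (w N)"
  shows "\<exists>e. \<forall>N. agree_upto N (w N) e"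
proof (intro exI allI)
  fix N
  show "agree_upto N (w N) (Abs_mps (\<lambda>m. coeff (w (size m)) m))"
    using assms agree_uptoD by (fastforce simp: agree_upto_def)
qed

lemma isCont_agree_upto:
  fixes T :: "('x, 'k::ab_group_add) mps \<Rightarrow> ('y, 'l::ab_group_add) mps"
  assumes "\<And>N a. agree_upto N a b \<Longrightarrow> agree_upto N (T a) (T b)"
  shows "isCont T b"
  unfolding continuous_at_eps_delta
proof (intro allI impI)
  fix e :: real assume "0 < e"
  then obtain N :: nat where N: "1 / 2 ^ N < e" by (rule half_power_small)
  have "dist (T a) (T b) < e" if "dist a b < 1 / 2 ^ N" for a
    using that N assms[of N a] by (simp add: dist_less_iff_agree_upto)
      (meson dist_less_iff_agree_upto less_trans)
  then show "\<exists>d>0. \<forall>a. dist a b < d \<longrightarrow> dist (T a) (T b) < e"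
    by (intro exI[of _ "1 / 2 ^ N"]) auto
qed

text \<open>This is where the finiteness of the set of indeterminates enters: it makes truncations
  finite sums and elimination up to a given degree terminate.\<close>

lemma finite_monomials_upto: "finite {m :: 'x::finite multiset. size m \<le> N}"
proof -
  have "{m :: 'x multiset. size m \<le> N} = (\<Union>n\<le>N. multisets_of_size UNIV n)"
    by (auto simp: multisets_of_size_def)
  then show ?thesis by auto
qed

definition truncate :: "nat \<Rightarrow> ('x, 'k::field) mps \<Rightarrow> ('x, 'k) mps" where
  "truncate N f = (\<Sum>m | size m \<le> N. scale (coeff f m) (mps_monom m))"

lemma coeff_sum: "coeff (sum f A) m = (\<Sum>a\<in>A. coeff (f a) m)"
  by (induction A rule: infinite_finite_induct) auto

lemma agree_upto_truncate:
  "agree_upto N (truncate N f) (f :: ('x::finite, 'k::field) mps)"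
proof -
  have "coeff (truncate N f) m = coeff f m" if "size m \<le> N" for m
  proof -
    have "coeff (truncate N f) m = (\<Sum>m' | size m' \<le> N. if m = m' then coeff f m' else 0)"
      unfolding truncate_def coeff_sum by (rule sum.cong) (auto simp: coeff_monom)
    also have "\<dots> = coeff f m"
      using that by (simp add: finite_monomials_upto)
    finally show ?thesis .
  qed
  then show ?thesis by (simp add: agree_upto_def)
qed


section \<open>Subspaces and ideals\<close>

interpretation vs: vector_space "scale :: 'k::field \<Rightarrow> ('x, 'k) mps \<Rightarrow> ('x, 'k) mps"
  by (rule vector_space_scale)

lemma subspace_closure:
  assumes V: "vs.subspace V"
  shows "vs.subspace (closure V)"
proof (rule vs.subspaceI)
  show "0 \<in> closure V"
    using vs.subspace_0[OF V] closure_subset by blast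
next
  fix x y assume xy: "x \<in> closure V" "y \<in> closure V"
  show "x + y \<in> closure V"
    unfolding mem_closure_iff
  proof
    fix N
    from xy obtain x' y' where "x' \<in> V" "y' \<in> V" "agree_upto N x' x" "agree_upto N y' y"
      unfolding mem_closure_iff by blast
    then show "\<exists>g\<in>V. agree_upto N g (x + y)"
      by (intro bexI[of _ "x' + y'"] vs.subspace_add[OF V]) (simp_all add: agree_upto_def)
  qed
next
  fix c x assume x: "x \<in> closure V"
  show "scale c x \<in> closure V"
    unfolding mem_closure_iff
  proof
    fix N
    from x obtain x' where "x' \<in> V" "agree_upto N x' x"
      unfolding mem_closure_iff by blast
    then show "\<exists>g\<in>V. agree_upto N g (scale c x)"
      by (intro bexI[of _ "scale c x'"] vs.subspace_scale[OF V]) (simp_all add: agree_upto_def)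
  qed
qed

lemma scale_mult: "scale c f * g = scale c (f * g)"
  by (rule mps_eqI) (simp add: coeff_times case_prod_beta sum_distrib_left mult.assoc)

lemma scale_eq_mult: "scale c f = scale c 1 * f"
  by (simp add: scale_mult)

lemma subspace_ideal_gen: "vs.subspace (ideal_gen R :: ('x, 'k::field) mps set)"
  unfolding ideal_gen_def
proof (rule vs.subspaceI)
  fix c :: 'k and x :: "('x, 'k) mps"
  assume "x \<in> module.span (*) R"
  then have "scale c 1 * x \<in> module.span (*) R"
    by (rule module.span_scale[OF module_mps])
  then show "scale c x \<in> module.span (*) R"
    by (simp flip: scale_eq_mult)
qed (simp_all add: module.span_zero[OF module_mps] module.span_add[OF module_mps])

lemma ideal_gen_singleton: "ideal_gen {f} = range (\<lambda>g. g * f)"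
  by (simp add: ideal_gen_def module.span_singleton[OF module_mps])

lemma ideal_gen_mono: "A \<subseteq> B \<Longrightarrow> ideal_gen A \<subseteq> ideal_gen B"
  by (simp add: ideal_gen_def module.span_mono[OF module_mps])


section \<open>Leading monomials\<close>

locale local_monomial_order =
  fixes lt :: "'x::finite multiset \<Rightarrow> 'x multiset \<Rightarrow> bool" (infix "\<sqsubset>" 50)
  assumes order: "deg_monomial_order (\<sqsubset>)"
begin

lemma irrefl: "\<not> m \<sqsubset> m"
  using order by (auto simp: deg_monomial_order_def irreflp_def)

lemma trans [trans]: "a \<sqsubset> b \<Longrightarrow> b \<sqsubset> c \<Longrightarrow> a \<sqsubset> c"
  using order unfolding deg_monomial_order_def by (meson transpE)

lemma asym: "a \<sqsubset> b \<Longrightarrow> \<not> b \<sqsubset> a"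
  using trans irrefl by blast

lemma total: "a \<sqsubset> b \<or> a = b \<or> b \<sqsubset> a"
  using order unfolding deg_monomial_order_def by (metis totalpD)

lemma add_right: "a \<sqsubset> b \<Longrightarrow> a + c \<sqsubset> b + c"
  using order by (simp add: deg_monomial_order_def)

lemma add_left: "a \<sqsubset> b \<Longrightarrow> c + a \<sqsubset> c + b"
  using add_right[of a b c] by (simp add: add.commute)

lemma size_less: "size a < size b \<Longrightarrow> a \<sqsubset> b"
  using order by (simp add: deg_monomial_order_def)

lemma size_le: "a \<sqsubset> b \<Longrightarrow> size a \<le> size b"
  using size_less[of b a] asym[of a b] by (auto simp: not_le[symmetric])

lemma ex_minimal:
  assumes "m \<in> B"
  obtains z where "z \<in> B" "\<And>y. y \<in> B \<Longrightarrow> y = z \<or> z \<sqsubset> y"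
proof -
  from order have "wfp (\<sqsubset>)" by (simp add: deg_monomial_order_def)
  with assms obtain z where "z \<in> B" "\<And>y. y \<sqsubset> z \<Longrightarrow> y \<notin> B"
    unfolding wfp_iff_ex_minimal by (metis empty_iff)
  then show ?thesis using that[of z] total by blast
qed

lemma lm_eqI:
  assumes "m \<in> supp f" "\<And>m'. m' \<in> supp f \<Longrightarrow> m' = m \<or> m \<sqsubset> m'"
  shows "lm (\<sqsubset>) f = m"
  unfolding lm_def
proof (rule the_equality)
  show "m \<in> supp f \<and> (\<forall>m'\<in>supp f. m' \<noteq> m \<longrightarrow> (\<sqsubset>)\<inverse>\<inverse> m' m)"
    using assms by auto
next
  fix z assume z: "z \<in> supp f \<and> (\<forall>m'\<in>supp f. m' \<noteq> z \<longrightarrow> (\<sqsubset>)\<inverse>\<inverse> m' z)"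
  with assms(1) have "m = z \<or> z \<sqsubset> m" by auto
  moreover have "z = m \<or> m \<sqsubset> z" using z assms(2) by blast
  ultimately show "z = m" using asym by blast
qed

lemma lm_in_supp: "f \<noteq> 0 \<Longrightarrow> lm (\<sqsubset>) f \<in> supp f"
  and lm_least: "f \<noteq> 0 \<Longrightarrow> m \<in> supp f \<Longrightarrow> m = lm (\<sqsubset>) f \<or> lm (\<sqsubset>) f \<sqsubset> m"
proof -
  assume "f \<noteq> 0"
  then obtain m0 where "m0 \<in> supp f" using supp_nonempty by blast
  then obtain z where z: "z \<in> supp f" "\<And>y. y \<in> supp f \<Longrightarrow> y = z \<or> z \<sqsubset> y"
    by (rule ex_minimal) blast
  from lm_eqI[OF z] have "lm (\<sqsubset>) f = z" by blast
  with z show "lm (\<sqsubset>) f \<in> supp f"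
    and "m \<in> supp f \<Longrightarrow> m = lm (\<sqsubset>) f \<or> lm (\<sqsubset>) f \<sqsubset> m" by auto
qed

lemma size_lm_le: "m \<in> supp f \<Longrightarrow> size (lm (\<sqsubset>) f) \<le> size m"
  using lm_least[of f m] size_le by (fastforce simp: supp_iff)

lemma lmsI: "f \<in> V \<Longrightarrow> f \<noteq> 0 \<Longrightarrow> lm (\<sqsubset>) f \<in> lms (\<sqsubset>) V"
  by (simp add: lms_def)

lemma lm_agree_upto:
  assumes "agree_upto N f g" "f \<noteq> 0" "size (lm (\<sqsubset>) f) \<le> N"
  shows "g \<noteq> 0" "lm (\<sqsubset>) g = lm (\<sqsubset>) f"
proof -
  have g: "lm (\<sqsubset>) f \<in> supp g"
    using assms lm_in_supp[of f] agree_uptoD[of N f g] by (auto simp: supp_iff)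
  then show "g \<noteq> 0" by (auto simp: supp_iff)
  show "lm (\<sqsubset>) g = lm (\<sqsubset>) f"
  proof (rule lm_eqI[OF g])
    fix m assume m: "m \<in> supp g"
    show "m = lm (\<sqsubset>) f \<or> lm (\<sqsubset>) f \<sqsubset> m"
    proof (cases "size m \<le> N")
      case True
      with m assms(1) have "m \<in> supp f" by (simp add: supp_iff agree_uptoD)
      then show ?thesis using assms(2) lm_least by blast
    next
      case False
      then show ?thesis using assms(3) size_less[of "lm (\<sqsubset>) f" m] by simp
    qed
  qed
qed

text \<open>
  Since the order refines the degree, the leading monomial only depends on a truncation; this is
  why the closure of an ideal can replace the ideal itself throughout.
\<close>

lemma lms_closure: "lms (\<sqsubset>) (closure S) = lms (\<sqsubset>) (S :: ('x, 'k::ab_group_add) mps set)"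
proof
  show "lms (\<sqsubset>) S \<subseteq> lms (\<sqsubset>) (closure S)"
    unfolding lms_def using closure_subset by blast
  show "lms (\<sqsubset>) (closure S) \<subseteq> lms (\<sqsubset>) S"
  proof
    fix m assume "m \<in> lms (\<sqsubset>) (closure S)"
    then obtain f where f: "f \<in> closure S" "f \<noteq> 0" "m = lm (\<sqsubset>) f" by (auto simp: lms_def)
    then obtain g where g: "g \<in> S" "agree_upto (size m) g f"
      unfolding mem_closure_iff by blast
    from lm_agree_upto[OF agree_upto_sym[OF g(2)] f(2)] f(3)
    have "g \<noteq> 0" "lm (\<sqsubset>) g = m" by auto
    with g(1) show "m \<in> lms (\<sqsubset>) S" by (auto dest: lmsI)
  qed
qed

text \<open>
  A product of monomials from the two supports can only equal the product of the leading monomials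
  if both factors are leading, so the coefficient there is a single nonzero product.
\<close>

lemma lm_mult:
  fixes f g :: "('x, 'k::field) mps"
  assumes "f \<noteq> 0" "g \<noteq> 0"
  shows "f * g \<noteq> 0" "lm (\<sqsubset>) (f * g) = lm (\<sqsubset>) f + lm (\<sqsubset>) g"
proof -
  let ?a = "lm (\<sqsubset>) f" and ?b = "lm (\<sqsubset>) g"
  have above: "a = ?a \<and> b = ?b \<or> ?a + ?b \<sqsubset> a + b" if "a \<in> supp f" "b \<in> supp g" for a b
  proof -
    from lm_least[OF assms(1) that(1)] lm_least[OF assms(2) that(2)]
    show ?thesis using add_right[of ?a a ?b] add_left[of ?b b a] trans by blast
  qed
  have "coeff (f * g) (?a + ?b) =
      (\<Sum>p\<in>splits (?a + ?b). if p = (?a, ?b) then coeff f ?a * coeff g ?b else 0)"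
    unfolding coeff_times
  proof (rule sum.cong[OF refl])
    fix p assume p: "p \<in> splits (?a + ?b)"
    obtain a b where ab: "p = (a, b)" by force
    with p have "a + b = ?a + ?b" by (simp add: splits_def)
    then have "coeff f a = 0 \<or> coeff g b = 0" if "p \<noteq> (?a, ?b)"
      using above[of a b] that ab irrefl by (auto simp: supp_iff)
    then show "(case p of (a, b) \<Rightarrow> coeff f a * coeff g b) =
        (if p = (?a, ?b) then coeff f ?a * coeff g ?b else 0)"
      using ab by auto
  qed
  also have "\<dots> = coeff f ?a * coeff g ?b"
    by (subst sum.delta[OF finite_splits]) (simp add: splits_def)
  finally have lead: "?a + ?b \<in> supp (f * g)"
    using lm_in_supp[OF assms(1)] lm_in_supp[OF assms(2)] by (simp add: supp_iff)
  then show "f * g \<noteq> 0" by (auto simp: supp_iff)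
  show "lm (\<sqsubset>) (f * g) = ?a + ?b"
  proof (rule lm_eqI[OF lead])
    fix m assume "m \<in> supp (f * g)"
    then have "(\<Sum>(a, b)\<in>splits m. coeff f a * coeff g b) \<noteq> 0"
      by (simp add: supp_iff coeff_times)
    then obtain p where p: "p \<in> splits m" "(case p of (a, b) \<Rightarrow> coeff f a * coeff g b) \<noteq> 0"
      by (meson sum.not_neutral_contains_not_neutral)
    then have "fst p \<in> supp f" "snd p \<in> supp g" "m = fst p + snd p"
      by (auto simp: supp_iff splits_def case_prod_beta)
    then show "m = ?a + ?b \<or> ?a + ?b \<sqsubset> m"
      using above[of "fst p" "snd p"] by auto
  qed
qed

lemma monom_nonzero: "(mps_monom m :: ('x, 'k::field) mps) \<noteq> 0"
proof
  assume "(mps_monom m :: ('x, 'k) mps) = 0"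
  then have "coeff (mps_monom m :: ('x, 'k) mps) m = 0" by simp
  then show False by (simp add: coeff_monom)
qed

lemma lm_monom: "lm (\<sqsubset>) (mps_monom m :: ('x, 'k::field) mps) = m"
  by (rule lm_eqI) (auto simp: supp_iff coeff_monom split: if_splits)

lemma lms_principal:
  fixes f :: "('x, 'k::field) mps"
  shows "lms (\<sqsubset>) (closure (ideal_gen {f})) = {m. f \<noteq> 0 \<and> lm (\<sqsubset>) f \<subseteq># m}"
  unfolding lms_closure
proof (intro set_eqI iffI)
  fix m assume "m \<in> lms (\<sqsubset>) (ideal_gen {f})"
  then obtain g where "g * f \<noteq> 0" "m = lm (\<sqsubset>) (g * f)"
    by (auto simp: lms_def ideal_gen_singleton)
  moreover from this have "g \<noteq> 0" "f \<noteq> 0" by auto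
  ultimately show "m \<in> {m. f \<noteq> 0 \<and> lm (\<sqsubset>) f \<subseteq># m}" by (simp add: lm_mult)
next
  fix m assume "m \<in> {m. f \<noteq> 0 \<and> lm (\<sqsubset>) f \<subseteq># m}"
  then obtain q where q: "f \<noteq> 0" "m = q + lm (\<sqsubset>) f"
    by (metis mem_Collect_eq subset_mset.add_diff_inverse add.commute)
  have "mps_monom q * f \<noteq> 0" "lm (\<sqsubset>) (mps_monom q * f) = m"
    using q lm_mult[OF monom_nonzero, of f q] by (auto simp: lm_monom)
  moreover have "mps_monom q * f \<in> ideal_gen {f}"
    by (auto simp: ideal_gen_singleton)
  ultimately show "m \<in> lms (\<sqsubset>) (ideal_gen {f})" using lmsI by metis
qed


section \<open>Normal forms modulo a closed subspace\<close>

definition normal_form :: "('x, 'k::field) mps set \<Rightarrow> ('x, 'k) mps \<Rightarrow> ('x, 'k) mps \<Rightarrow> bool" where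
  "normal_form V v w \<longleftrightarrow> v - w \<in> V \<and> supp w \<inter> lms (\<sqsubset>) V = {}"

text \<open>
  The uniqueness principle: a nonzero difference would have its leading monomial in
  \<open>lms (\<sqsubset>) V\<close>, hence outside both supports.
\<close>

lemma agree_upto_of_diff_mem:
  assumes "u - w \<in> V"
    and "\<And>m. m \<in> lms (\<sqsubset>) V \<Longrightarrow> size m \<le> N \<Longrightarrow> coeff u m = 0 \<and> coeff w m = 0"
  shows "agree_upto N u w"
proof (rule ccontr)
  assume "\<not> agree_upto N u w"
  then obtain m where m: "size m \<le> N" "m \<in> supp (u - w)"
    by (auto simp: agree_upto_def supp_iff)
  then have nz: "u - w \<noteq> 0" by (auto simp: supp_iff)
  then have "coeff u (lm (\<sqsubset>) (u - w)) = 0 \<and> coeff w (lm (\<sqsubset>) (u - w)) = 0"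
    using assms lmsI size_lm_le[OF m(2)] m(1) le_trans by blast
  then show False using lm_in_supp[OF nz] by (simp add: supp_iff)
qed

text \<open>
  If \<open>a'\<close> and \<open>b'\<close> differ first at a monomial \<open>m\<close> of degree at most \<open>N\<close>, then \<open>m\<close> also leads the
  element \<open>(b - b') - (a - a')\<close> of \<open>V\<close>, as \<open>a\<close> and \<open>b\<close> do not interfere in these degrees; but
  normal forms avoid such monomials.
\<close>

lemma normal_form_nonexpansive:
  assumes V: "vs.subspace V" and "normal_form V a a'" "normal_form V b b'" "agree_upto N a b"
  shows "agree_upto N a' b'"
proof (rule ccontr)
  assume "\<not> agree_upto N a' b'"
  then obtain m where m: "size m \<le> N" "m \<in> supp (a' - b')"
    by (auto simp: agree_upto_def supp_iff)
  then have nz: "a' - b' \<noteq> 0" by (auto simp: supp_iff)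
  let ?d = "(b - b') - (a - a')"
  have "?d \<in> V"
    using assms(2,3) vs.subspace_diff[OF V] by (simp add: normal_form_def)
  moreover have "agree_upto N (a' - b') ?d"
    using assms(4) by (simp add: agree_upto_def)
  ultimately have "lm (\<sqsubset>) (a' - b') \<in> lms (\<sqsubset>) V"
    using lm_agree_upto[OF _ nz] size_lm_le[OF m(2)] m(1) lmsI by (metis le_trans)
  then have "lm (\<sqsubset>) (a' - b') \<notin> supp a'" "lm (\<sqsubset>) (a' - b') \<notin> supp b'"
    using assms(2,3) by (auto simp: normal_form_def)
  then show False using lm_in_supp[OF nz] by (simp add: supp_iff)
qed

lemma normal_form_eq:
  assumes "vs.subspace V" "normal_form V a a'" "normal_form V b b'" "a - b \<in> V"
  shows "a' = b'"
proof -
  have "a - b' \<in> V"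
    using vs.subspace_add[OF assms(1,4)] assms(3) by (force simp: normal_form_def)
  with assms(3) have "normal_form V a b'" by (simp add: normal_form_def)
  then show ?thesis
    using normal_form_nonexpansive[OF assms(1,2)] by (blast intro: agree_upto_eqI agree_upto_refl)
qed

lemma normal_form_lm_diff:
  assumes "normal_form V v w" "v \<noteq> w"
  shows "lm (\<sqsubset>) (v - w) \<in> lms (\<sqsubset>) V \<inter> supp v"
proof -
  have "lm (\<sqsubset>) (v - w) \<in> lms (\<sqsubset>) V"
    using assms by (intro lmsI) (auto simp: normal_form_def)
  moreover from this have "lm (\<sqsubset>) (v - w) \<notin> supp w"
    using assms(1) by (auto simp: normal_form_def)
  moreover have "lm (\<sqsubset>) (v - w) \<in> supp (v - w)"
    using assms(2) by (simp add: lm_in_supp)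
  ultimately show ?thesis by (simp add: supp_iff)
qed

text \<open>
  If a step can always raise the least monomial of \<open>L\<close> in the support, then finitely many steps
  clear all monomials of \<open>L\<close> up to a given degree: the set of monomials of bounded degree that lie
  above some monomial of \<open>L\<close> in the support is finite and shrinks. This serves both for the
  elimination modulo a subspace and for the rewriting relation.
\<close>

lemma eliminate_upto:
  assumes step: "\<And>v m. m \<in> supp v \<inter> L \<Longrightarrow> (\<And>m'. m' \<in> supp v \<inter> L \<Longrightarrow> m' = m \<or> m \<sqsubset> m') \<Longrightarrow>
      \<exists>v'. r v v' \<and> (\<forall>m'\<in>supp v' \<inter> L. m \<sqsubset> m')"
  shows "\<exists>w. r\<^sup>*\<^sup>* v w \<and> (\<forall>m\<in>L. size m \<le> N \<longrightarrow> coeff w m = 0)"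
proof (induction "card {m. size m \<le> N \<and> (\<exists>m0\<in>supp v \<inter> L. m0 = m \<or> m0 \<sqsubset> m)}"
    arbitrary: v rule: less_induct)
  case less
  let ?B = "\<lambda>v. {m. size m \<le> N \<and> (\<exists>m0\<in>supp v \<inter> L. m0 = m \<or> m0 \<sqsubset> m)}"
  show ?case
  proof (cases "\<exists>m\<in>L. size m \<le> N \<and> coeff v m \<noteq> 0")
    case False
    then show ?thesis by blast
  next
    case True
    then obtain m1 where m1: "m1 \<in> supp v \<inter> L" "size m1 \<le> N" by (auto simp: supp_iff)
    from m1(1) obtain m where m: "m \<in> supp v \<inter> L" "\<And>m'. m' \<in> supp v \<inter> L \<Longrightarrow> m' = m \<or> m \<sqsubset> m'"
      by (rule ex_minimal) blast
    have "size m \<le> N" using m(2)[OF m1(1)] m1(2) size_le[of m m1] by auto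
    obtain v' where v': "r v v'" "\<forall>m'\<in>supp v' \<inter> L. m \<sqsubset> m'" using step[OF m] by blast
    have "?B v' \<subseteq> ?B v" using m(1) v'(2) trans by blast
    moreover have "m \<in> ?B v" using m(1) \<open>size m \<le> N\<close> by blast
    moreover have "m \<notin> ?B v'" using v'(2) asym irrefl by blast
    ultimately have "?B v' \<subset> ?B v" by blast
    moreover have "finite (?B v)"
      by (rule finite_subset[OF _ finite_monomials_upto[of N]]) blast
    ultimately have "card (?B v') < card (?B v)" by (rule psubset_card_mono[rotated])
    from less[OF this] obtain w where "r\<^sup>*\<^sup>* v' w" "\<forall>m\<in>L. size m \<le> N \<longrightarrow> coeff w m = 0"
      by blast
    then show ?thesis using v'(1) by (meson converse_rtranclp_into_rtranclp)
  qed
qed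

text \<open>
  Elimination gives elements of \<open>v + V\<close> that are clear up to any given degree; by the uniqueness
  principle they are coherent, and their limit stays in \<open>v + V\<close> because \<open>V\<close> is closed.
\<close>

lemma normal_form_exists:
  fixes V :: "('x, 'k::field) mps set"
  assumes V: "vs.subspace V" and "closed V"
  shows "\<exists>w. normal_form V v w"
proof -
  let ?r = "\<lambda>v v'. v - v' \<in> V"
  have r_star: "v - w \<in> V" if "?r\<^sup>*\<^sup>* v w" for v w
    using that
  proof (induction rule: rtranclp_induct)
    case base
    then show ?case by (simp add: vs.subspace_0[OF V])
  next
    case (step y z)
    then have "(v - y) + (y - z) \<in> V" by (intro vs.subspace_add[OF V])
    then show ?case by simp
  qed
  have "\<exists>w. ?r\<^sup>*\<^sup>* v w \<and> (\<forall>m\<in>lms (\<sqsubset>) V. size m \<le> N \<longrightarrow> coeff w m = 0)" for N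
  proof (rule eliminate_upto)
    fix v :: "('x, 'k) mps" and m
    assume m: "m \<in> supp v \<inter> lms (\<sqsubset>) V"
      "\<And>m'. m' \<in> supp v \<inter> lms (\<sqsubset>) V \<Longrightarrow> m' = m \<or> m \<sqsubset> m'"
    from m(1) obtain g where g: "g \<in> V" "g \<noteq> 0" "m = lm (\<sqsubset>) g" by (auto simp: lms_def)
    define v' where "v' = v - scale (coeff v m / coeff g m) g"
    have "m' = m \<or> m \<sqsubset> m'" if "m' \<in> supp v' \<inter> lms (\<sqsubset>) V" for m'
    proof (cases "m' \<in> supp v")
      case True
      then show ?thesis using that m(2) by blast
    next
      case False
      with that have "m' \<in> supp g" by (auto simp: v'_def supp_iff)
      then show ?thesis using g lm_least by blast
    qed
    moreover have "m \<notin> supp v'"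
      using lm_in_supp[OF g(2)] g(3) by (simp add: v'_def supp_iff)
    ultimately have "\<forall>m'\<in>supp v' \<inter> lms (\<sqsubset>) V. m \<sqsubset> m'" by blast
    moreover have "v - v' \<in> V"
      using vs.subspace_scale[OF V g(1)] by (simp add: v'_def)
    ultimately show "\<exists>v'. v - v' \<in> V \<and> (\<forall>m'\<in>supp v' \<inter> lms (\<sqsubset>) V. m \<sqsubset> m')" by blast
  qed
  then obtain w where w: "\<And>N. ?r\<^sup>*\<^sup>* v (w N)"
    and clear: "\<And>N m. m \<in> lms (\<sqsubset>) V \<Longrightarrow> size m \<le> N \<Longrightarrow> coeff (w N) m = 0"
    by metis
  have "agree_upto M (w M) (w N)" if "M \<le> N" for M N
  proof (rule agree_upto_of_diff_mem)
    have "(v - w N) - (v - w M) \<in> V"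
      by (intro vs.subspace_diff[OF V] r_star w)
    then show "w M - w N \<in> V" by simp
  qed (use clear that in auto)
  then obtain e where e: "\<And>N. agree_upto N (w N) e" using agree_upto_limit[of w] by blast
  have "v - e \<in> closure V"
    unfolding mem_closure_iff
  proof
    fix N
    show "\<exists>g\<in>V. agree_upto N g (v - e)"
      using r_star[OF w[of N]] e[of N]
      by (intro bexI[of _ "v - w N"]) (simp_all add: agree_upto_def)
  qed
  moreover have "coeff e m = 0" if "m \<in> lms (\<sqsubset>) V" for m
    using clear[OF that order_refl] agree_uptoD[OF e order_refl, of m] by simp
  ultimately have "normal_form V v e"
    using \<open>closed V\<close> by (auto simp: normal_form_def supp_iff)
  then show ?thesis ..
qed


section \<open>Reduction operators compute normal forms\<close>

text \<open>
  Both \<open>v\<close> and its normal form modulo the kernel have the same image under \<open>T\<close>, so it is enough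
  that \<open>T\<close> fixes normal forms. Since the kernel determines normal forms, it also determines \<open>T\<close>.
\<close>

lemma reduction_operator_normal_form:
  fixes T :: "('x, 'k::field) mps \<Rightarrow> ('x, 'k) mps"
  assumes T: "reduction_operator (\<sqsubset>) T"
  shows "normal_form {v. T v = 0} v (T v)"
proof -
  let ?V = "{v. T v = 0}"
  from T have cont: "continuous_on UNIV T" and idem: "\<And>v. T (T v) = T v"
    and lin: "Vector_Spaces.linear scale scale T"
    and below: "\<And>m m'. T (mps_monom m) \<noteq> mps_monom m \<Longrightarrow> m' \<in> supp (T (mps_monom m)) \<Longrightarrow> m \<sqsubset> m'"
    by (auto simp: reduction_operator_def fun_eq_iff)
  interpret T: Vector_Spaces.linear scale scale T by (rule lin)
  have fixed_monom: "T (mps_monom m) = mps_monom m" if "m \<notin> lms (\<sqsubset>) ?V" for m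
  proof (rule ccontr)
    assume ne: "T (mps_monom m) \<noteq> mps_monom m"
    let ?g = "mps_monom m - T (mps_monom m)"
    have "lm (\<sqsubset>) ?g = m"
    proof (rule lm_eqI)
      have "m \<notin> supp (T (mps_monom m))" using below[OF ne] irrefl by blast
      then show "m \<in> supp ?g" by (simp add: supp_iff coeff_monom)
    next
      fix m' assume "m' \<in> supp ?g"
      then have "m' = m \<or> m' \<in> supp (T (mps_monom m))"
        by (auto simp: supp_iff coeff_monom split: if_splits)
      then show "m' = m \<or> m \<sqsubset> m'" using below[OF ne] by blast
    qed
    moreover have "?g \<in> ?V" by (simp add: T.diff idem)
    ultimately show False using that lmsI[of ?g ?V] ne by auto
  qed
  \<comment> \<open>The fixed points form a closed subspace, so series avoiding the leading monomials of the
      kernel inherit being fixed from their monomials.\<close>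
  have fixed: "T w = w" if w: "supp w \<inter> lms (\<sqsubset>) ?V = {}" for w
  proof -
    have "T (truncate N w) = truncate N w" for N
      unfolding truncate_def T.sum T.scale
    proof (rule sum.cong[OF refl])
      fix m
      show "scale (coeff w m) (T (mps_monom m)) = scale (coeff w m) (mps_monom m)"
      proof (cases "m \<in> supp w")
        case True
        with w have "m \<notin> lms (\<sqsubset>) ?V" by blast
        then show ?thesis by (simp add: fixed_monom)
      qed (simp add: supp_iff)
    qed
    then have "w \<in> closure {u. T u = u}"
      unfolding mem_closure_iff using agree_upto_truncate by blast
    moreover have "closed {u. T u = u}"
      by (intro closed_Collect_eq cont continuous_on_id)
    ultimately show ?thesis by simp
  qed
  have V: "vs.subspace ?V"
    by (rule vs.subspaceI) (simp_all add: T.add T.scale)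
  have "closed ?V"
    by (intro closed_Collect_eq cont continuous_on_const)
  with V obtain w where w: "normal_form ?V v w" using normal_form_exists by blast
  then have "T v = T w" by (simp add: normal_form_def T.diff)
  also have "T w = w" using w by (intro fixed) (simp add: normal_form_def)
  finally show ?thesis using w by simp
qed

lemma reduction_operator_exists:
  fixes V :: "('x, 'k::field) mps set"
  assumes V: "vs.subspace V" and "closed V"
  shows "\<exists>T. reduction_operator (\<sqsubset>) T \<and> {v. T v = 0} = V"
proof -
  from normal_form_exists[OF assms] obtain T where T: "\<And>v. normal_form V v (T v)" by metis
  have T_eqI: "T v = w" if "normal_form V v w" for v w
    by (rule normal_form_eq[OF V T that]) (simp add: vs.subspace_0[OF V])
  have mem: "v - T v \<in> V" and avoid: "m \<in> lms (\<sqsubset>) V \<Longrightarrow> coeff (T v) m = 0" for v m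
    using T[of v] by (auto simp: normal_form_def supp_iff)
  have "T (a + b) = T a + T b" for a b
  proof (rule T_eqI)
    have "(a - T a) + (b - T b) \<in> V" using mem by (intro vs.subspace_add[OF V])
    then show "normal_form V (a + b) (T a + T b)"
      by (auto simp: normal_form_def supp_iff avoid algebra_simps)
  qed
  moreover have "T (scale c a) = scale c (T a)" for c a
  proof (rule T_eqI)
    have "scale c (a - T a) \<in> V" using mem by (intro vs.subspace_scale[OF V])
    then show "normal_form V (scale c a) (scale c (T a))"
      by (auto simp: normal_form_def supp_iff avoid vs.scale_right_diff_distrib)
  qed
  ultimately have "Vector_Spaces.linear scale scale T"
    by (simp add: Vector_Spaces.linear_iff vector_space_scale)
  moreover have "isCont T b" for b
    by (rule isCont_agree_upto) (rule normal_form_nonexpansive[OF V T T])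
  then have "continuous_on UNIV T" by (simp add: continuous_on_eq_continuous_at)
  moreover have "T (T v) = T v" for v
    by (rule T_eqI) (use T[of v] vs.subspace_0[OF V] in \<open>simp add: normal_form_def\<close>)
  then have "T \<circ> T = T" by (simp add: fun_eq_iff)
  moreover have "m \<sqsubset> m'"
    if ne: "T (mps_monom m) \<noteq> mps_monom m" and m': "m' \<in> supp (T (mps_monom m))" for m m'
  proof -
    let ?g = "mps_monom m - T (mps_monom m)"
    \<comment> \<open>The monomial itself is the only candidate for the leading monomial of the difference.\<close>
    have lm: "lm (\<sqsubset>) ?g \<in> lms (\<sqsubset>) V" "lm (\<sqsubset>) ?g = m"
      using normal_form_lm_diff[OF T not_sym[OF ne]]
      by (auto simp: supp_iff coeff_monom split: if_splits)
    then have "m' \<noteq> m" using m' avoid by (auto simp: supp_iff)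
    moreover from this have "m' \<in> supp ?g" using m' by (simp add: supp_iff coeff_monom)
    ultimately show ?thesis using lm_least[of ?g m'] ne lm(2) by auto
  qed
  ultimately have "reduction_operator (\<sqsubset>) T"
    by (simp add: reduction_operator_def)
  moreover have "T v = 0 \<longleftrightarrow> v \<in> V" for v
  proof
    assume "T v = 0"
    then show "v \<in> V" using mem[of v] by simp
  next
    assume "v \<in> V"
    then show "T v = 0" by (intro T_eqI) (simp add: normal_form_def supp_def)
  qed
  ultimately show ?thesis by blast
qed

lemma red_op_normal_form:
  "normal_form (closure (ideal_gen {f})) v (red_op (\<sqsubset>) f v)"
proof -
  let ?V = "closure (ideal_gen {f})"
  have V: "vs.subspace ?V" by (rule subspace_closure[OF subspace_ideal_gen])
  then obtain T where T: "reduction_operator (\<sqsubset>) T \<and> {v. T v = 0} = ?V"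
    using reduction_operator_exists[OF _ closed_closure] by blast
  have "T' = T" if "reduction_operator (\<sqsubset>) T' \<and> {v. T' v = 0} = ?V" for T'
  proof
    fix v
    have "normal_form ?V v (T' v)" "normal_form ?V v (T v)"
      using that T reduction_operator_normal_form by metis+
    then show "T' v = T v"
      by (rule normal_form_eq[OF V]) (simp add: vs.subspace_0[OF V])
  qed
  with T have "red_op (\<sqsubset>) f = T"
    unfolding red_op_def by (intro the_equality) blast+
  with T show ?thesis using reduction_operator_normal_form[of T v] by simp
qed

lemma red_op_nonexpansive:
  "agree_upto N a b \<Longrightarrow> agree_upto N (red_op (\<sqsubset>) f a) (red_op (\<sqsubset>) f b)"
  by (rule normal_form_nonexpansive[OF subspace_closure[OF subspace_ideal_gen]
        red_op_normal_form red_op_normal_form])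

lemma red_op_eq:
  assumes "a - b \<in> ideal_gen {f}"
  shows "red_op (\<sqsubset>) f a = red_op (\<sqsubset>) f b"
proof (rule normal_form_eq[OF subspace_closure[OF subspace_ideal_gen]
      red_op_normal_form red_op_normal_form])
  show "a - b \<in> closure (ideal_gen {f})" using assms closure_subset by blast
qed

text \<open>
  A step by \<open>f\<close> only changes what lies at or above a multiple of the leading monomial of \<open>f\<close> in
  the support of \<open>v\<close>: the leading monomial of \<open>v - red_op (\<sqsubset>) f v\<close> is one of the ideal, so it is absent from the normal form and has to
  come from \<open>v\<close>.
\<close>

lemma red_op_change:
  assumes "coeff (red_op (\<sqsubset>) f v) m \<noteq> coeff v m"
  obtains m0 where "m0 \<in> supp v" "f \<noteq> 0" "lm (\<sqsubset>) f \<subseteq># m0" "m0 = m \<or> m0 \<sqsubset> m"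
proof -
  let ?d = "v - red_op (\<sqsubset>) f v"
  from assms have ne: "v \<noteq> red_op (\<sqsubset>) f v" and "m \<in> supp ?d" by (auto simp: supp_iff)
  then have "lm (\<sqsubset>) ?d = m \<or> lm (\<sqsubset>) ?d \<sqsubset> m" using lm_least[of ?d m] by auto
  moreover have "lm (\<sqsubset>) ?d \<in> lms (\<sqsubset>) (closure (ideal_gen {f})) \<inter> supp v"
    by (rule normal_form_lm_diff[OF red_op_normal_form ne])
  ultimately show ?thesis using that[of "lm (\<sqsubset>) ?d"] by (simp add: lms_principal)
qed

lemma coeff_red_op_multiple:
  "f \<noteq> 0 \<Longrightarrow> lm (\<sqsubset>) f \<subseteq># m \<Longrightarrow> coeff (red_op (\<sqsubset>) f v) m = 0"
  using red_op_normal_form[of f v] by (auto simp: normal_form_def lms_principal supp_iff)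


section \<open>Standard bases and confluence\<close>

abbreviation rewrites_to :: "('x, 'k::field) mps set \<Rightarrow> ('x, 'k) mps \<Rightarrow> ('x, 'k) mps \<Rightarrow> bool" where
  "rewrites_to R \<equiv> (rewr (red_op (\<sqsubset>) ` R))\<^sup>*\<^sup>*"

definition reducible :: "('x, 'k::field) mps set \<Rightarrow> 'x multiset set" where
  "reducible R = {m. \<exists>m'\<in>lms (\<sqsubset>) R. m' \<subseteq># m}"

lemma reducible_iff: "m \<in> reducible R \<longleftrightarrow> (\<exists>f\<in>R. f \<noteq> 0 \<and> lm (\<sqsubset>) f \<subseteq># m)"
  by (auto simp: reducible_def lms_def)

lemma standard_basis_iff:
  "standard_basis (\<sqsubset>) R (ideal_gen R) \<longleftrightarrow> lms (\<sqsubset>) (ideal_gen R) \<subseteq> reducible R"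
  by (auto simp: standard_basis_def reducible_def)

lemma rewrites_diff:
  assumes "rewrites_to R a b"
  shows "a - b \<in> closure (ideal_gen R)"
  using assms
proof (induction rule: rtranclp_induct)
  case base
  then show ?case by (simp add: vs.subspace_0[OF subspace_closure[OF subspace_ideal_gen]])
next
  case (step b c)
  from step.hyps(2) obtain f where f: "f \<in> R" "c = red_op (\<sqsubset>) f b" by (auto simp: rewr_def)
  have "b - c \<in> closure (ideal_gen {f})"
    using red_op_normal_form[of f b] f(2) by (simp add: normal_form_def)
  moreover have "closure (ideal_gen {f}) \<subseteq> closure (ideal_gen R)"
    using f(1) by (intro closure_mono ideal_gen_mono) auto
  ultimately have "(a - b) + (b - c) \<in> closure (ideal_gen R)"
    using step.IH by (intro vs.subspace_add[OF subspace_closure[OF subspace_ideal_gen]]) auto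
  then show ?case by simp
qed

text \<open>Rewriting descends to truncations, as every step is nonexpansive.\<close>

lemma rewrites_agree_upto:
  assumes "rewrites_to R a a'" "agree_upto N a b"
  obtains b' where "rewrites_to R b b'" "agree_upto N a' b'"
  using assms(1)
proof (induction arbitrary: thesis rule: rtranclp_induct)
  case base
  then show ?case using assms(2) by blast
next
  case (step y z)
  from step.IH obtain b' where b': "rewrites_to R b b'" "agree_upto N y b'" by blast
  from step.hyps(2) obtain f where f: "f \<in> R" "z = red_op (\<sqsubset>) f y" by (auto simp: rewr_def)
  have "rewr (red_op (\<sqsubset>) ` R) b' (red_op (\<sqsubset>) f b')" using f(1) by (auto simp: rewr_def)
  with b' f(2) show ?case
    using step.prems[of "red_op (\<sqsubset>) f b'"] red_op_nonexpansive by (meson rtranclp.rtrancl_into_rtrancl)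
qed

text \<open>
  Applying the reduction operator of \<open>f\<close>, where the leading monomial of \<open>f\<close> divides the least
  reducible monomial \<open>m\<close> in the support, kills \<open>m\<close> and changes nothing below it.
\<close>

lemma rewrites_irreducible_upto:
  fixes R :: "('x, 'k::field) mps set"
  shows
  "\<exists>w. rewrites_to R v w \<and> (\<forall>m\<in>reducible R. size m \<le> N \<longrightarrow> coeff w m = 0)"
proof (rule eliminate_upto)
  fix v :: "('x, 'k) mps" and m
  assume m: "m \<in> supp v \<inter> reducible R"
    and least: "\<And>m'. m' \<in> supp v \<inter> reducible R \<Longrightarrow> m' = m \<or> m \<sqsubset> m'"
  from m obtain f where f: "f \<in> R" "f \<noteq> 0" "lm (\<sqsubset>) f \<subseteq># m" by (auto simp: reducible_iff)
  let ?w = "red_op (\<sqsubset>) f v"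
  have "m \<sqsubset> m'" if m': "m' \<in> supp ?w \<inter> reducible R" for m'
  proof -
    have "m' \<noteq> m" using coeff_red_op_multiple[OF f(2,3)] m' by (auto simp: supp_iff)
    moreover have "m' = m \<or> m \<sqsubset> m'"
    proof (cases "m' \<in> supp v")
      case True
      then show ?thesis using m' least by blast
    next
      case False
      with m' have "coeff ?w m' \<noteq> coeff v m'" by (auto simp: supp_iff)
      then obtain m0 where m0: "m0 \<in> supp v" "lm (\<sqsubset>) f \<subseteq># m0" "m0 = m' \<or> m0 \<sqsubset> m'"
        by (rule red_op_change)
      then have "m0 = m \<or> m \<sqsubset> m0" using least f by (auto simp: reducible_iff)
      then show ?thesis using m0(3) trans by blast
    qed
    ultimately show ?thesis by blast
  qed
  then show "\<exists>v'. rewr (red_op (\<sqsubset>) ` R) v v' \<and> (\<forall>m'\<in>supp v' \<inter> reducible R. m \<sqsubset> m')"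
    using f(1) by (auto simp: rewr_def)
qed

lemma confluent_if_standard_basis:
  assumes "lms (\<sqsubset>) (ideal_gen R) \<subseteq> reducible R"
  shows "top_confluent (red_op (\<sqsubset>) ` R)"
  unfolding top_confluent_def
proof (intro allI impI, elim conjE)
  fix a b c assume ab: "rewrites_to R a b" and ac: "rewrites_to R a c"
  let ?irr = "\<lambda>N w. \<forall>m\<in>reducible R. size m \<le> N \<longrightarrow> coeff w m = 0"
  have coherent: "agree_upto M u w"
    if "rewrites_to R a u" "rewrites_to R a w" "?irr M u" "?irr M w" for M u w
  proof (rule agree_upto_of_diff_mem)
    have "(a - w) - (a - u) \<in> closure (ideal_gen R)"
      using that(1,2) by (intro vs.subspace_diff[OF subspace_closure[OF subspace_ideal_gen]] rewrites_diff)
    then show "u - w \<in> closure (ideal_gen R)" by simp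
    show "coeff u m = 0 \<and> coeff w m = 0"
      if "m \<in> lms (\<sqsubset>) (closure (ideal_gen R))" "size m \<le> M" for m
      using that assms \<open>?irr M u\<close> \<open>?irr M w\<close> by (auto simp: lms_closure)
  qed
  obtain u where u: "\<And>N. rewrites_to R b (u N)" "\<And>N. ?irr N (u N)"
    using rewrites_irreducible_upto[of R b] by metis
  obtain w where w: "\<And>N. rewrites_to R c (w N)" "\<And>N. ?irr N (w N)"
    using rewrites_irreducible_upto[of R c] by metis
  have au: "rewrites_to R a (u N)" and aw: "rewrites_to R a (w N)" for N
    using ab ac u(1)[of N] w(1)[of N] by auto
  have "agree_upto M (u M) (u N)" if "M \<le> N" for M N
    using that u(2)[of N] by (intro coherent au u(2)) auto
  then obtain e where e: "\<And>N. agree_upto N (u N) e" using agree_upto_limit[of u] by blast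
  have "agree_upto N (w N) e" for N
    using coherent[OF aw au w(2) u(2)] e agree_upto_trans by blast
  then have "top_rewr (red_op (\<sqsubset>) ` R) b e" "top_rewr (red_op (\<sqsubset>) ` R) c e"
    unfolding top_rewr_iff using e u(1) w(1) by blast+
  then show "\<exists>e. top_rewr (red_op (\<sqsubset>) ` R) b e \<and> top_rewr (red_op (\<sqsubset>) ` R) c e" by blast
qed

definition joinable_upto :: "('x, 'k::field) mps set \<Rightarrow> nat \<Rightarrow> ('x, 'k) mps \<Rightarrow> ('x, 'k) mps \<Rightarrow> bool" where
  "joinable_upto R N a b \<longleftrightarrow>
     (\<exists>a' b'. rewrites_to R a a' \<and> rewrites_to R b b' \<and> agree_upto N a' b')"

text \<open>
  Up to a fixed degree, topological confluence gives ordinary confluence, because reduction operators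
  do not expand distances; this gives transitivity as in the Church-Rosser theorem.
\<close>

lemma joinable_upto_trans:
  assumes conf: "top_confluent (red_op (\<sqsubset>) ` R)"
    and "joinable_upto R N a b" "joinable_upto R N b c"
  shows "joinable_upto R N a c"
proof -
  from assms(2,3) obtain a' b1 b2 c'
    where a': "rewrites_to R a a'" and b1: "rewrites_to R b b1" and ab: "agree_upto N a' b1"
      and b2: "rewrites_to R b b2" and c': "rewrites_to R c c'" and bc: "agree_upto N b2 c'"
    by (auto simp: joinable_upto_def)
  from conf b1 b2 obtain e
    where "top_rewr (red_op (\<sqsubset>) ` R) b1 e" "top_rewr (red_op (\<sqsubset>) ` R) b2 e"
    unfolding top_confluent_def by blast
  then obtain e1 e2 where e1: "rewrites_to R b1 e1" "agree_upto N e1 e"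
    and e2: "rewrites_to R b2 e2" "agree_upto N e2 e"
    unfolding top_rewr_iff by blast
  obtain a'' where a'': "rewrites_to R a' a''" "agree_upto N e1 a''"
    using rewrites_agree_upto[OF e1(1) agree_upto_sym[OF ab]] by blast
  obtain c'' where c'': "rewrites_to R c' c''" "agree_upto N e2 c''"
    using rewrites_agree_upto[OF e2(1) bc] by blast
  have "agree_upto N a'' c''"
    using a''(2) c''(2) e1(2) e2(2) by (simp add: agree_upto_def)
  moreover have "rewrites_to R a a''" "rewrites_to R c c''"
    using a' a''(1) c' c''(1) by auto
  ultimately show ?thesis unfolding joinable_upto_def by blast
qed

lemma ideal_joinable_zero:
  assumes conf: "top_confluent (red_op (\<sqsubset>) ` R)" and "h \<in> ideal_gen R"
  shows "joinable_upto R N h 0"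
  using assms(2) unfolding ideal_gen_def
proof (induction rule: module.span_induct_alt[OF module_mps, consumes 1, case_names base step])
  case base
  then show ?case unfolding joinable_upto_def using agree_upto_refl by blast
next
  case (step c f y)
  have "(c * f + y) - y \<in> ideal_gen {f}" by (auto simp: ideal_gen_singleton)
  then have "red_op (\<sqsubset>) f (c * f + y) = red_op (\<sqsubset>) f y" by (rule red_op_eq)
  moreover have "rewrites_to R v (red_op (\<sqsubset>) f v)" for v
    using step.hyps by (intro r_into_rtranclp) (auto simp: rewr_def)
  ultimately have "joinable_upto R N (c * f + y) y"
    unfolding joinable_upto_def by (metis agree_upto_refl)
  then show ?case using joinable_upto_trans[OF conf] step.IH by blast
qed

lemma rewrites_zero:
  assumes "rewrites_to R 0 w"
  shows "w = 0"
  using assms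
proof (induction rule: rtranclp_induct)
  case (step y z)
  then obtain f where f: "z = red_op (\<sqsubset>) f 0" by (auto simp: rewr_def)
  have "coeff z m = 0" for m
    using red_op_change[of f 0 m] f by (auto simp: supp_iff)
  then show ?case by (simp add: mps_eqI)
qed simp

text \<open>An irreducible leading monomial survives rewriting, as only larger monomials can change.\<close>

lemma rewrites_irreducible_lm:
  assumes "rewrites_to R h w" "h \<noteq> 0" "lm (\<sqsubset>) h \<notin> reducible R"
  shows "w \<noteq> 0 \<and> lm (\<sqsubset>) w = lm (\<sqsubset>) h"
  using assms(1)
proof (induction rule: rtranclp_induct)
  case base
  then show ?case using assms(2) by simp
next
  case (step y z)
  let ?m = "lm (\<sqsubset>) h"
  from step.hyps(2) obtain f where f: "f \<in> R" "z = red_op (\<sqsubset>) f y" by (auto simp: rewr_def)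
  have same: "coeff z m = coeff y m" if "m = ?m \<or> m \<sqsubset> ?m" for m
  proof (rule ccontr)
    assume "coeff z m \<noteq> coeff y m"
    then obtain m0 where m0: "m0 \<in> supp y" "f \<noteq> 0" "lm (\<sqsubset>) f \<subseteq># m0" "m0 = m \<or> m0 \<sqsubset> m"
      using red_op_change f(2) by metis
    then have "m0 = ?m \<or> ?m \<sqsubset> m0" using step.IH lm_least[of y m0] by auto
    with m0(4) that have "m0 = ?m" using trans asym by blast
    then show False using m0 f(1) assms(3) by (auto simp: reducible_iff)
  qed
  have m: "?m \<in> supp z" using same[of ?m] lm_in_supp[of y] step.IH by (simp add: supp_iff)
  moreover have "lm (\<sqsubset>) z = ?m"
  proof (rule lm_eqI[OF m])
    fix m' assume m': "m' \<in> supp z"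
    show "m' = ?m \<or> ?m \<sqsubset> m'"
    proof (rule ccontr)
      assume a: "\<not> (m' = ?m \<or> ?m \<sqsubset> m')"
      then have "m' \<sqsubset> ?m" using total by blast
      with same m' have "m' \<in> supp y" by (simp add: supp_iff)
      then show False using a step.IH lm_least[of y m'] by auto
    qed
  qed
  ultimately show ?case by (auto simp: supp_iff)
qed

lemma standard_basis_if_confluent:
  assumes conf: "top_confluent (red_op (\<sqsubset>) ` R)"
  shows "lms (\<sqsubset>) (ideal_gen R) \<subseteq> reducible R"
proof
  fix m assume "m \<in> lms (\<sqsubset>) (ideal_gen R)"
  then obtain h where h: "h \<in> ideal_gen R" "h \<noteq> 0" "m = lm (\<sqsubset>) h" by (auto simp: lms_def)
  show "m \<in> reducible R"
  proof (rule ccontr)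
    assume irr: "m \<notin> reducible R"
    obtain w z where w: "rewrites_to R h w" "rewrites_to R 0 z" "agree_upto (size m) w z"
      using ideal_joinable_zero[OF conf h(1)] unfolding joinable_upto_def by blast
    then have "coeff w m = 0"
      using rewrites_zero[OF w(2)] agree_uptoD[OF w(3), of m] by simp
    moreover have "m \<in> supp w"
      using rewrites_irreducible_lm[OF w(1) h(2)] irr h(3) lm_in_supp[of w] by simp
    ultimately show False by (simp add: supp_iff)
  qed
qed

end

theorem theorem4p1p3:
  fixes lt :: "'x::finite multiset \<Rightarrow> 'x multiset \<Rightarrow> bool"
    and R :: "('x, 'k::field) mps set"
  assumes "deg_monomial_order lt"
  shows "standard_basis lt R (ideal_gen R) \<longleftrightarrow> top_confluent (red_op lt ` R)"
proof -
  interpret local_monomial_order lt by unfold_locales (rule assms)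
  show ?thesis
    unfolding standard_basis_iff
    using confluent_if_standard_basis standard_basis_if_confluent by blast
qed

end
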